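(* Let $\mathscr{M}$ be a bicategory, let $j : A \to B$, $f : A \to X$, $r : B \to X$ be 1-morphisms of $\mathscr{M}$, and let $\rho : rj \Rightarrow f$ be a 2-morphism. Let $i_0 : B \to \mathrm{C}(j)$, $i_1 : A \to \mathrm{C}(j)$, $\nu : i_0 j \Rightarrow i_1$ be a collage of $j$ in $\mathscr{M}$, and let $\langle r, \rho\rangle : \mathrm{C}(j) \to X$ be the 1-morphism induced by $\rho$, with its canonical invertible 2-morphism $\langle r,\rho\rangle i_1 \cong f$. Then, in $\mathscr{M}$, the invertible 2-morphism $\langle r,\rho\rangle i_1 \cong f$ exhibits $\langle r, \rho\rangle$ as a right extension of $f$ along $i_1$ if and only if $\rho$ exhibits $r$ as a right extension of $f$ along $j$.
   Context: Right extension: a 2-morphism $\rho : rj \Rightarrow f$ (with $j : A\to B$, $f : A\to X$, $r : B \to X$) exhibits $r$ as a right extension of $f$ along $j$ in $\mathscr{M}$ when, for every 1-morphism $g : B \to X$, the assignment $\theta \mapsto \rho\cdot(\theta j)$ is a bijection between 2-morphisms $\theta : g \Rightarrow r$ and 2-morphisms $gj \Rightarrow f$. Collage: a collage (lax colimit) of $j : A \to B$ in $\mathscr{M}$ is an object $\mathrm{C}(j)$ with 1-morphisms $i_0 : B \to \mathrm{C}(j)$, $i_1 : A \to \mathrm{C}(j)$ and a 2-morphism $\nu : i_0 j \Rightarrow i_1$ which is universal: for every object $X$, the functor $h \mapsto (hi_0,\ h\nu : hi_0 j \Rightarrow hi_1,\ hi_1)$ is an equivalence of categories $$\mathscr{M}(\mathrm{C}(j),X)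 \simeq \mathscr{M}(j,X)/\mathscr{M}(A,X),$$ where the right-hand side is the comma category of the functor $\mathscr{M}(j,X) : \mathscr{M}(B,X) \to \mathscr{M}(A,X)$ (precomposition with $j$) and the identity functor of $\mathscr{M}(A,X)$; its objects are triples $(r, \rho : rj \Rightarrow f, f)$ with $r : B \to X$, $f : A \to X$. Induced 1-morphism: by this universal property, $\rho : rj\Rightarrow f$ induces a 1-morphism $\langle r,\rho\rangle : \mathrm{C}(j) \to X$ together with invertible 2-morphisms $f \cong \langle r,\rho\rangle i_1$ and $r \cong \langle r,\rho\rangle i_0$ which conjugate $\langle r,\rho\rangle\nu$ to give $\rho$. *)

theory Defs
  imports Main
begin

section \<open>Categories, functors, equivalences, comma categories\<close>

record ('o, 'a) cat =
  Obj :: "'o set"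
  Arr :: "'a set"
  Dom :: "'a \<Rightarrow> 'o"
  Cod :: "'a \<Rightarrow> 'o"
  Ide :: "'o \<Rightarrow> 'a"
  Comp :: "'a \<Rightarrow> 'a \<Rightarrow> 'a"  (infixl "\<cdot>\<index>" 65)

definition hom :: "('o, 'a) cat \<Rightarrow> 'o \<Rightarrow> 'o \<Rightarrow> 'a set" where
  "hom C x y = {a \<in> Arr C. Dom C a = x \<and> Cod C a = y}"

definition is_iso :: "('o, 'a) cat \<Rightarrow> 'a \<Rightarrow> bool" where
  "is_iso C a \<longleftrightarrow> a \<in> Arr C \<and>
     (\<exists>b \<in> hom C (Cod C a) (Dom C a).
        b \<cdot>\<^bsub>C\<^esub> a = Ide C (Dom C a) \<and> a \<cdot>\<^bsub>C\<^esub> b = Ide C (Cod C a))"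

locale category =
  fixes C :: "('o, 'a) cat" (structure)
  assumes Dom_Obj: "a \<in> Arr C \<Longrightarrow> Dom C a \<in> Obj C"
    and Cod_Obj: "a \<in> Arr C \<Longrightarrow> Cod C a \<in> Obj C"
    and Ide_hom: "x \<in> Obj C \<Longrightarrow> Ide C x \<in> hom C x x"
    and Comp_hom: "a \<in> hom C x y \<Longrightarrow> b \<in> hom C y z \<Longrightarrow> b \<cdot> a \<in> hom C x z"
    and Comp_Ide: "a \<in> hom C x y \<Longrightarrow> a \<cdot> Ide C x = a"
    and Ide_Comp: "a \<in> hom C x y \<Longrightarrow> Ide C y \<cdot> a = a"
    and Comp_assoc: "a \<in> hom C w x \<Longrightarrow> b \<in> hom C x y \<Longrightarrow> c \<in> hom C y z
      \<Longrightarrow> (c \<cdot> b) \<cdot> a = c \<cdot> (b \<cdot> a)"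

record ('o1, 'a1, 'o2, 'a2) fctr =
  FObj :: "'o1 \<Rightarrow> 'o2"
  FArr :: "'a1 \<Rightarrow> 'a2"

definition id_fctr :: "('o, 'a, 'o, 'a) fctr" where
  "id_fctr = \<lparr>FObj = (\<lambda>x. x), FArr = (\<lambda>a. a)\<rparr>"

definition comp_fctr ::
  "('o2, 'a2, 'o3, 'a3) fctr \<Rightarrow> ('o1, 'a1, 'o2, 'a2) fctr \<Rightarrow> ('o1, 'a1, 'o3, 'a3) fctr" where
  "comp_fctr G F = \<lparr>FObj = (\<lambda>x. FObj G (FObj F x)), FArr = (\<lambda>a. FArr G (FArr F a))\<rparr>"

locale is_functor = C: category C + D: category D
  for C :: "('o1, 'a1) cat" and D :: "('o2, 'a2) cat" +
  fixes F :: "('o1, 'a1, 'o2, 'a2) fctr"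
  assumes FObj: "x \<in> Obj C \<Longrightarrow> FObj F x \<in> Obj D"
    and FArr: "a \<in> hom C x y \<Longrightarrow> FArr F a \<in> hom D (FObj F x) (FObj F y)"
    and FArr_Ide: "x \<in> Obj C \<Longrightarrow> FArr F (Ide C x) = Ide D (FObj F x)"
    and FArr_Comp: "a \<in> hom C x y \<Longrightarrow> b \<in> hom C y z
      \<Longrightarrow> FArr F (b \<cdot>\<^bsub>C\<^esub> a) = FArr F b \<cdot>\<^bsub>D\<^esub> FArr F a"

definition is_nat_iso ::
  "('o1, 'a1) cat \<Rightarrow> ('o2, 'a2) cat \<Rightarrow> ('o1, 'a1, 'o2, 'a2) fctr \<Rightarrow> ('o1, 'a1, 'o2, 'a2) fctr
    \<Rightarrow> ('o1 \<Rightarrow> 'a2) \<Rightarrow> bool" where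
  "is_nat_iso C D F G \<tau> \<longleftrightarrow>
     (\<forall>x \<in> Obj C. \<tau> x \<in> hom D (FObj F x) (FObj G x) \<and> is_iso D (\<tau> x)) \<and>
     (\<forall>a \<in> Arr C. \<tau> (Cod C a) \<cdot>\<^bsub>D\<^esub> FArr F a = FArr G a \<cdot>\<^bsub>D\<^esub> \<tau> (Dom C a))"

definition is_equivalence ::
  "('o1, 'a1) cat \<Rightarrow> ('o2, 'a2) cat \<Rightarrow> ('o1, 'a1, 'o2, 'a2) fctr \<Rightarrow> bool" where
  "is_equivalence C D F \<longleftrightarrow> is_functor C D F \<and>
     (\<exists>G \<eta> \<epsilon>. is_functor D C G \<and>
        is_nat_iso C C id_fctr (comp_fctr G F) \<eta> \<and>
        is_nat_iso D D (comp_fctr F G) id_fctr \<epsilon>)"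

text \<open>
  The comma category of \<open>F : C \<rightarrow> E\<close> and \<open>G : D \<rightarrow> E\<close>. Objects are triples
  \<open>(c, e, d)\<close> with \<open>e : F c \<rightarrow> G d\<close>; an arrow carries its source and target triples
  along with the pair \<open>(u, v)\<close>, which on its own does not determine them.
\<close>

type_synonym ('oC, 'aC, 'oD, 'aD, 'aE) comma_arr =
  "('oC \<times> 'aE \<times> 'oD) \<times> ('oC \<times> 'aE \<times> 'oD) \<times> 'aC \<times> 'aD"

definition comma ::
  "('oC, 'aC) cat \<Rightarrow> ('oD, 'aD) cat \<Rightarrow> ('oE, 'aE) cat
    \<Rightarrow> ('oC, 'aC, 'oE, 'aE) fctr \<Rightarrow> ('oD, 'aD, 'oE, 'aE) fctr
    \<Rightarrow> ('oC \<times> 'aE \<times> 'oD, ('oC, 'aC, 'oD, 'aD, 'aE) comma_arr) cat" where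
  "comma C D E F G =
     (let O' = {(c, e, d). c \<in> Obj C \<and> d \<in> Obj D \<and> e \<in> hom E (FObj F c) (FObj G d)}
      in \<lparr>Obj = O',
          Arr = {((c, e, d), (c', e', d'), u, v).
                   (c, e, d) \<in> O' \<and> (c', e', d') \<in> O' \<and>
                   u \<in> hom C c c' \<and> v \<in> hom D d d' \<and>
                   e' \<cdot>\<^bsub>E\<^esub> FArr F u = FArr G v \<cdot>\<^bsub>E\<^esub> e},
          Dom = (\<lambda>(s, t, u, v). s),
          Cod = (\<lambda>(s, t, u, v). t),
          Ide = (\<lambda>(c, e, d). ((c, e, d), (c, e, d), Ide C c, Ide D d)),
          Comp = (\<lambda>(s', t', u', v') (s, t, u, v). (s, t', u' \<cdot>\<^bsub>C\<^esub> u, v' \<cdot>\<^bsub>D\<^esub> v))\<rparr>)"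


section \<open>Bicategories\<close>

text \<open>
  \<open>Vert\<close> is the disjoint union of the hom-categories: its objects are all 1-morphisms, its
  arrows all 2-morphisms, and its composition is vertical composition. Composites are written
  in function order, so \<open>g \<odot> f\<close> is \<open>f\<close> followed by \<open>g\<close>, and
  \<open>Assoc h g f : (h \<odot> g) \<odot> f \<Rightarrow> h \<odot> (g \<odot> f)\<close>.
\<close>

record ('o, 'm, 'c) bicat =
  Ob :: "'o set"
  Vert :: "('m, 'c) cat"
  Src :: "'m \<Rightarrow> 'o"
  Trg :: "'m \<Rightarrow> 'o"
  One :: "'o \<Rightarrow> 'm"
  HComp :: "'m \<Rightarrow> 'm \<Rightarrow> 'm"  (infixl "\<odot>\<index>" 75)
  HComp2 :: "'c \<Rightarrow> 'c \<Rightarrow> 'c"  (infixl "\<star>\<index>" 75)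
  Assoc :: "'m \<Rightarrow> 'm \<Rightarrow> 'm \<Rightarrow> 'c"
  LUnit :: "'m \<Rightarrow> 'c"
  RUnit :: "'m \<Rightarrow> 'c"

abbreviation vcomp :: "('o, 'm, 'c) bicat \<Rightarrow> 'c \<Rightarrow> 'c \<Rightarrow> 'c"  (infixl "\<bullet>\<index>" 65) where
  "b \<bullet>\<^bsub>M\<^esub> a \<equiv> Comp (Vert M) b a"

abbreviation id2 :: "('o, 'm, 'c) bicat \<Rightarrow> 'm \<Rightarrow> 'c" where
  "id2 M \<equiv> Ide (Vert M)"

definition hom1 :: "('o, 'm, 'c) bicat \<Rightarrow> 'o \<Rightarrow> 'o \<Rightarrow> 'm set" where
  "hom1 M A B = {f \<in> Obj (Vert M). Src M f = A \<and> Trg M f = B}"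

abbreviation hom2 :: "('o, 'm, 'c) bicat \<Rightarrow> 'm \<Rightarrow> 'm \<Rightarrow> 'c set" where
  "hom2 M \<equiv> hom (Vert M)"

abbreviation invertible2 :: "('o, 'm, 'c) bicat \<Rightarrow> 'c \<Rightarrow> bool" where
  "invertible2 M \<equiv> is_iso (Vert M)"

locale bicategory =
  fixes M :: "('o, 'm, 'c) bicat" (structure)
  assumes category_Vert: "category (Vert M)"
    and Src_Ob: "f \<in> Obj (Vert M) \<Longrightarrow> Src M f \<in> Ob M"
    and Trg_Ob: "f \<in> Obj (Vert M) \<Longrightarrow> Trg M f \<in> Ob M"
    and parallel: "a \<in> hom2 M f f' \<Longrightarrow> Src M f = Src M f' \<and> Trg M f = Trg M f'"
    and One_hom1: "A \<in> Ob M \<Longrightarrow> One M A \<in> hom1 M A A"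
    and HComp_hom1: "\<lbrakk>f \<in> hom1 M A B; g \<in> hom1 M B C\<rbrakk> \<Longrightarrow> g \<odot> f \<in> hom1 M A C"
    and HComp2_hom2:
      "\<lbrakk>f \<in> hom1 M A B; g \<in> hom1 M B C; a \<in> hom2 M f f'; b \<in> hom2 M g g'\<rbrakk>
        \<Longrightarrow> b \<star> a \<in> hom2 M (g \<odot> f) (g' \<odot> f')"
    and HComp2_id2:
      "\<lbrakk>f \<in> hom1 M A B; g \<in> hom1 M B C\<rbrakk> \<Longrightarrow> id2 M g \<star> id2 M f = id2 M (g \<odot> f)"
    and interchange:
      "\<lbrakk>f \<in> hom1 M A B; g \<in> hom1 M B C;
        a \<in> hom2 M f f'; a' \<in> hom2 M f' f''; b \<in> hom2 M g g'; b' \<in> hom2 M g' g''\<rbrakk>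
        \<Longrightarrow> (b' \<bullet> b) \<star> (a' \<bullet> a) = (b' \<star> a') \<bullet> (b \<star> a)"
    and Assoc_hom2:
      "\<lbrakk>f \<in> hom1 M A B; g \<in> hom1 M B C; h \<in> hom1 M C D\<rbrakk>
        \<Longrightarrow> Assoc M h g f \<in> hom2 M ((h \<odot> g) \<odot> f) (h \<odot> (g \<odot> f))"
    and Assoc_invertible:
      "\<lbrakk>f \<in> hom1 M A B; g \<in> hom1 M B C; h \<in> hom1 M C D\<rbrakk> \<Longrightarrow> invertible2 M (Assoc M h g f)"
    and Assoc_natural:
      "\<lbrakk>f \<in> hom1 M A B; g \<in> hom1 M B C; h \<in> hom1 M C D;
        a \<in> hom2 M f f'; b \<in> hom2 M g g'; c \<in> hom2 M h h'\<rbrakk>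
        \<Longrightarrow> Assoc M h' g' f' \<bullet> ((c \<star> b) \<star> a) = (c \<star> (b \<star> a)) \<bullet> Assoc M h g f"
    and LUnit_hom2: "f \<in> hom1 M A B \<Longrightarrow> LUnit M f \<in> hom2 M (One M B \<odot> f) f"
    and LUnit_invertible: "f \<in> hom1 M A B \<Longrightarrow> invertible2 M (LUnit M f)"
    and LUnit_natural:
      "\<lbrakk>f \<in> hom1 M A B; a \<in> hom2 M f f'\<rbrakk>
        \<Longrightarrow> LUnit M f' \<bullet> (id2 M (One M B) \<star> a) = a \<bullet> LUnit M f"
    and RUnit_hom2: "f \<in> hom1 M A B \<Longrightarrow> RUnit M f \<in> hom2 M (f \<odot> One M A) f"
    and RUnit_invertible: "f \<in> hom1 M A B \<Longrightarrow> invertible2 M (RUnit M f)"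
    and RUnit_natural:
      "\<lbrakk>f \<in> hom1 M A B; a \<in> hom2 M f f'\<rbrakk>
        \<Longrightarrow> RUnit M f' \<bullet> (a \<star> id2 M (One M A)) = a \<bullet> RUnit M f"
    and pentagon:
      "\<lbrakk>f \<in> hom1 M A B; g \<in> hom1 M B C; h \<in> hom1 M C D; k \<in> hom1 M D E\<rbrakk>
        \<Longrightarrow> Assoc M k h (g \<odot> f) \<bullet> Assoc M (k \<odot> h) g f =
            (id2 M k \<star> Assoc M h g f) \<bullet> Assoc M k (h \<odot> g) f \<bullet> (Assoc M k h g \<star> id2 M f)"
    and triangle:
      "\<lbrakk>f \<in> hom1 M A B; g \<in> hom1 M B C\<rbrakk>
        \<Longrightarrow> (id2 M g \<star> LUnit M f) \<bullet> Assoc M g (One M B) f = RUnit M g \<star> id2 M f"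

definition hom_cat :: "('o, 'm, 'c) bicat \<Rightarrow> 'o \<Rightarrow> 'o \<Rightarrow> ('m, 'c) cat" where
  "hom_cat M A B = (Vert M)\<lparr>Obj := hom1 M A B,
     Arr := (\<Union>f \<in> hom1 M A B. \<Union>g \<in> hom1 M A B. hom2 M f g)\<rparr>"

text \<open>The functor \<open>M(j,X) : M(B,X) \<rightarrow> M(A,X)\<close>, for any \<open>X\<close>.\<close>

definition precomp :: "('o, 'm, 'c) bicat \<Rightarrow> 'm \<Rightarrow> ('m, 'c, 'm, 'c) fctr" where
  "precomp M j = \<lparr>FObj = (\<lambda>g. g \<odot>\<^bsub>M\<^esub> j), FArr = (\<lambda>\<theta>. \<theta> \<star>\<^bsub>M\<^esub> id2 M j)\<rparr>"


section \<open>Right extensions and collages\<close>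

definition exhibits_right_extension ::
  "('o, 'm, 'c) bicat \<Rightarrow> 'm \<Rightarrow> 'm \<Rightarrow> 'm \<Rightarrow> 'c \<Rightarrow> bool" where
  "exhibits_right_extension M j f r \<rho> \<longleftrightarrow>
     (\<exists>A B X. j \<in> hom1 M A B \<and> f \<in> hom1 M A X \<and> r \<in> hom1 M B X \<and>
        \<rho> \<in> hom2 M (r \<odot>\<^bsub>M\<^esub> j) f \<and>
        (\<forall>g \<in> hom1 M B X.
           bij_betw (\<lambda>\<theta>. \<rho> \<bullet>\<^bsub>M\<^esub> (\<theta> \<star>\<^bsub>M\<^esub> id2 M j)) (hom2 M g r) (hom2 M (g \<odot>\<^bsub>M\<^esub> j) f)))"

text \<open>
  For \<open>\<nu> : i\<^sub>0 \<odot> j \<Rightarrow> i\<^sub>1\<close>, the whiskering \<open>h \<nu>\<close> read as a 2-morphism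
  \<open>(h \<odot> i\<^sub>0) \<odot> j \<Rightarrow> h \<odot> i\<^sub>1\<close>, the associativity constraint being inserted explicitly.
\<close>

definition whisker_cocone ::
  "('o, 'm, 'c) bicat \<Rightarrow> 'm \<Rightarrow> 'm \<Rightarrow> 'c \<Rightarrow> 'm \<Rightarrow> 'c" where
  "whisker_cocone M j i\<^sub>0 \<nu> h = (id2 M h \<star>\<^bsub>M\<^esub> \<nu>) \<bullet>\<^bsub>M\<^esub> Assoc M h i\<^sub>0 j"

definition collage_fctr ::
  "('o, 'm, 'c) bicat \<Rightarrow> 'm \<Rightarrow> 'm \<Rightarrow> 'm \<Rightarrow> 'c
    \<Rightarrow> ('m, 'c, 'm \<times> 'c \<times> 'm, ('m, 'c, 'm, 'c, 'c) comma_arr) fctr" where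
  "collage_fctr M j i\<^sub>0 i\<^sub>1 \<nu> =
     (let K = (\<lambda>h. (h \<odot>\<^bsub>M\<^esub> i\<^sub>0, whisker_cocone M j i\<^sub>0 \<nu> h, h \<odot>\<^bsub>M\<^esub> i\<^sub>1))
      in \<lparr>FObj = K,
          FArr = (\<lambda>\<theta>. (K (Dom (Vert M) \<theta>), K (Cod (Vert M) \<theta>),
                       \<theta> \<star>\<^bsub>M\<^esub> id2 M i\<^sub>0, \<theta> \<star>\<^bsub>M\<^esub> id2 M i\<^sub>1))\<rparr>)"

definition is_collage ::
  "('o, 'm, 'c) bicat \<Rightarrow> 'o \<Rightarrow> 'o \<Rightarrow> 'm \<Rightarrow> 'o \<Rightarrow> 'm \<Rightarrow> 'm \<Rightarrow> 'c \<Rightarrow> bool" where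
  "is_collage M A B j C i\<^sub>0 i\<^sub>1 \<nu> \<longleftrightarrow>
     j \<in> hom1 M A B \<and> C \<in> Ob M \<and> i\<^sub>0 \<in> hom1 M B C \<and> i\<^sub>1 \<in> hom1 M A C \<and>
     \<nu> \<in> hom2 M (i\<^sub>0 \<odot>\<^bsub>M\<^esub> j) i\<^sub>1 \<and>
     (\<forall>X \<in> Ob M. is_equivalence (hom_cat M C X)
        (comma (hom_cat M B X) (hom_cat M A X) (hom_cat M A X) (precomp M j) id_fctr)
        (collage_fctr M j i\<^sub>0 i\<^sub>1 \<nu>))"

text \<open>
  \<open>h\<close> is a 1-morphism \<open>\<langle>r,\<rho>\<rangle> : C \<rightarrow> X\<close> induced by \<open>\<rho>\<close>, with its canonical
  invertible \<open>\<phi>\<^sub>0 : r \<cong> h i\<^sub>0\<close> and \<open>\<phi>\<^sub>1 : h i\<^sub>1 \<cong> f\<close>. Such data are unique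
  only up to isomorphism, so this is a predicate. Orienting \<open>\<phi>\<^sub>1\<close> towards \<open>f\<close>
  expresses conjugation of \<open>h \<nu>\<close> into \<open>\<rho>\<close> without naming an inverse.
\<close>

definition is_induced ::
  "('o, 'm, 'c) bicat \<Rightarrow> 'o \<Rightarrow> 'o \<Rightarrow> 'm \<Rightarrow> 'm \<Rightarrow> 'm \<Rightarrow> 'c \<Rightarrow> 'm \<Rightarrow> 'c \<Rightarrow> 'm
    \<Rightarrow> 'm \<Rightarrow> 'c \<Rightarrow> 'c \<Rightarrow> bool" where
  "is_induced M C X j i\<^sub>0 i\<^sub>1 \<nu> r \<rho> f h \<phi>\<^sub>0 \<phi>\<^sub>1 \<longleftrightarrow>
     h \<in> hom1 M C X \<and>
     \<phi>\<^sub>0 \<in> hom2 M r (h \<odot>\<^bsub>M\<^esub> i\<^sub>0) \<and> invertible2 M \<phi>\<^sub>0 \<and>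
     \<phi>\<^sub>1 \<in> hom2 M (h \<odot>\<^bsub>M\<^esub> i\<^sub>1) f \<and> invertible2 M \<phi>\<^sub>1 \<and>
     \<phi>\<^sub>1 \<bullet>\<^bsub>M\<^esub> whisker_cocone M j i\<^sub>0 \<nu> h \<bullet>\<^bsub>M\<^esub> (\<phi>\<^sub>0 \<star>\<^bsub>M\<^esub> id2 M j) = \<rho>"

end

theory Submission
  imports Defs
begin

text \<open>
  The universal property of the collage says that 2-morphisms \<open>g \<Rightarrow> h\<close> between 1-morphisms
  \<open>C \<rightarrow> X\<close> are pairs \<open>(u : g i\<^sub>0 \<Rightarrow> h i\<^sub>0, v : g i\<^sub>1 \<Rightarrow> h i\<^sub>1)\<close> compatible with \<open>\<nu>\<close>.
  If \<open>\<rho>\<close> is a right extension, then \<open>v\<close>, equivalently \<open>\<phi>\<^sub>1 v : g i\<^sub>1 \<Rightarrow> f\<close>, determines a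
  unique compatible \<open>u\<close>. Conversely, for \<open>g : B \<rightarrow> X\<close> choose \<open>k : C \<rightarrow> X\<close> inducing the
  identity of \<open>g j\<close>, so that \<open>k i\<^sub>0 \<cong> g\<close> and \<open>k i\<^sub>1 \<cong> g j\<close>; then 2-morphisms
  \<open>k \<Rightarrow> h\<close> correspond to \<open>g \<Rightarrow> r\<close> on the one hand and to \<open>g j \<Rightarrow> f\<close> on the other.
\<close>

section \<open>Categories and equivalences\<close>

lemma bij_betw_iff_unique_preimage:
  "bij_betw F S T \<longleftrightarrow> (\<forall>a\<in>S. F a \<in> T) \<and> (\<forall>b\<in>T. \<exists>!a. a \<in> S \<and> F a = b)"
  unfolding bij_betw_def inj_on_def by blast

lemma is_iso_hom:
  "a \<in> hom C x y \<Longrightarrow> is_iso C a \<longleftrightarrow>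
     (\<exists>b \<in> hom C y x. b \<cdot>\<^bsub>C\<^esub> a = Ide C x \<and> a \<cdot>\<^bsub>C\<^esub> b = Ide C y)"
  unfolding is_iso_def hom_def by auto

context category
begin

lemma hom_Obj: "a \<in> hom C x y \<Longrightarrow> x \<in> Obj C \<and> y \<in> Obj C"
  using Dom_Obj Cod_Obj unfolding hom_def by auto

lemma iso_cancel_left:
  assumes "e \<in> hom C y z" "is_iso C e" "a \<in> hom C x y" "b \<in> hom C x y" "e \<cdot> a = e \<cdot> b"
  shows "a = b"
proof -
  obtain i where i: "i \<in> hom C z y" "i \<cdot> e = Ide C y"
    using assms(1,2) is_iso_hom[of e C] by blast
  have "i \<cdot> e \<cdot> a = i \<cdot> e \<cdot> b"
    using Comp_assoc[OF assms(3,1) i(1)] Comp_assoc[OF assms(4,1) i(1)] assms(5) by simp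
  then show ?thesis using i(2) Ide_Comp assms(3,4) by simp
qed

lemma iso_cancel_right:
  assumes "e \<in> hom C x y" "is_iso C e" "a \<in> hom C y z" "b \<in> hom C y z" "a \<cdot> e = b \<cdot> e"
  shows "a = b"
proof -
  obtain i where i: "i \<in> hom C y x" "e \<cdot> i = Ide C y"
    using assms(1,2) is_iso_hom[of e C] by blast
  have "a \<cdot> (e \<cdot> i) = b \<cdot> (e \<cdot> i)"
    using Comp_assoc[OF i(1) assms(1,3)] Comp_assoc[OF i(1) assms(1,4)] assms(5) by simp
  then show ?thesis using i(2) Comp_Ide assms(3,4) by simp
qed

lemma iso_factor_left:
  assumes "e \<in> hom C y z" "is_iso C e" "a \<in> hom C x z"
  obtains b where "b \<in> hom C x y" "e \<cdot> b = a"
proof -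
  obtain i where i: "i \<in> hom C z y" "e \<cdot> i = Ide C z"
    using assms(1,2) is_iso_hom[of e C] by blast
  have "e \<cdot> (i \<cdot> a) = a"
    using Comp_assoc[OF assms(3) i(1) assms(1)] i(2) Ide_Comp assms(3) by simp
  then show ?thesis using that Comp_hom[OF assms(3) i(1)] by blast
qed

lemma iso_factor_right:
  assumes "e \<in> hom C x y" "is_iso C e" "a \<in> hom C x z"
  obtains b where "b \<in> hom C y z" "b \<cdot> e = a"
proof -
  obtain i where i: "i \<in> hom C y x" "i \<cdot> e = Ide C x"
    using assms(1,2) is_iso_hom[of e C] by blast
  have "a \<cdot> i \<cdot> e = a"
    using Comp_assoc[OF assms(1) i(1) assms(3)] i(2) Comp_Ide assms(3) by simp
  then show ?thesis using that Comp_hom[OF i(1) assms(3)] by blast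
qed

end

section \<open>Consequences of an equivalence of categories\<close>

text \<open>Naturality expresses \<open>\<eta> y \<cdot> a\<close> through \<open>FArr F a\<close>
  alone, and the invertible \<open>\<eta> y\<close> cancels.\<close>

lemma nat_iso_id_faithful:
  assumes "category C" "is_nat_iso C C id_fctr (comp_fctr G F) \<eta>"
    and a: "a \<in> hom C x y" and b: "b \<in> hom C x y" and eq: "FArr F a = FArr F b"
  shows "a = b"
proof -
  interpret category C by fact
  have \<eta>: "\<eta> y \<in> hom C y (FObj G (FObj F y))" "is_iso C (\<eta> y)"
    using assms(2) hom_Obj[OF a] by (auto simp: is_nat_iso_def id_fctr_def comp_fctr_def)
  have "\<eta> y \<cdot>\<^bsub>C\<^esub> c = FArr G (FArr F c) \<cdot>\<^bsub>C\<^esub> \<eta> x" if "c \<in> hom C x y" for c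
    using assms(2) that by (auto simp: is_nat_iso_def id_fctr_def comp_fctr_def hom_def)
  then have "\<eta> y \<cdot>\<^bsub>C\<^esub> a = \<eta> y \<cdot>\<^bsub>C\<^esub> b" using a b eq by simp
  with \<eta> a b show ?thesis by (rule iso_cancel_left)
qed

text \<open>The counit makes the quasi-inverse \<open>G\<close> faithful by the mirror argument;
  fullness of \<open>F\<close> will rest on this.\<close>

lemma nat_iso_to_id_faithful:
  assumes "category D" "is_nat_iso D D (comp_fctr F G) id_fctr \<epsilon>"
    and a: "a \<in> hom D x y" and b: "b \<in> hom D x y" and eq: "FArr G a = FArr G b"
  shows "a = b"
proof -
  interpret category D by fact
  have \<epsilon>: "\<epsilon> x \<in> hom D (FObj F (FObj G x)) x" "is_iso D (\<epsilon> x)"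
    using assms(2) hom_Obj[OF a] by (auto simp: is_nat_iso_def id_fctr_def comp_fctr_def)
  have "\<epsilon> y \<cdot>\<^bsub>D\<^esub> FArr F (FArr G c) = c \<cdot>\<^bsub>D\<^esub> \<epsilon> x" if "c \<in> hom D x y" for c
    using assms(2) that by (auto simp: is_nat_iso_def id_fctr_def comp_fctr_def hom_def)
  then have "a \<cdot>\<^bsub>D\<^esub> \<epsilon> x = b \<cdot>\<^bsub>D\<^esub> \<epsilon> x" using a b eq by metis
  with \<epsilon> a b show ?thesis by (rule iso_cancel_right)
qed

lemma equivalence_fully_faithful:
  assumes "is_equivalence C D F" and x: "x \<in> Obj C" and y: "y \<in> Obj C"
  shows "bij_betw (FArr F) (hom C x y) (hom D (FObj F x) (FObj F y))"
proof -
  from assms(1) obtain G \<eta> \<epsilon> where F: "is_functor C D F" and G: "is_functor D C G"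
    and \<eta>: "is_nat_iso C C id_fctr (comp_fctr G F) \<eta>"
    and \<epsilon>: "is_nat_iso D D (comp_fctr F G) id_fctr \<epsilon>"
    unfolding is_equivalence_def by blast
  interpret F: is_functor C D F by fact
  interpret G: is_functor D C G by fact
  have full: "\<exists>a. a \<in> hom C x y \<and> FArr F a = d" if d: "d \<in> hom D (FObj F x) (FObj F y)" for d
  proof -
    have \<eta>_iso: "\<eta> z \<in> hom C z (FObj G (FObj F z)) \<and> is_iso C (\<eta> z)" if "z \<in> Obj C" for z
      using \<eta> that by (auto simp: is_nat_iso_def id_fctr_def comp_fctr_def)
    have Gd: "FArr G d \<in> hom C (FObj G (FObj F x)) (FObj G (FObj F y))"
      using G.FArr[OF d] .
    \<comment> \<open>The candidate preimage of \<open>d\<close> is the conjugate of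
      \<open>FArr G d\<close> by the unit. It has the same image as \<open>d\<close> under
      \<open>G\<close>, by naturality of \<open>\<eta>\<close>, and \<open>G\<close> is
      faithful.\<close>
    obtain a where a: "a \<in> hom C x y" "\<eta> y \<cdot>\<^bsub>C\<^esub> a = FArr G d \<cdot>\<^bsub>C\<^esub> \<eta> x"
      using F.C.iso_factor_left \<eta>_iso[OF y] F.C.Comp_hom[OF conjunct1[OF \<eta>_iso[OF x]] Gd] by blast
    have "\<eta> y \<cdot>\<^bsub>C\<^esub> a = FArr G (FArr F a) \<cdot>\<^bsub>C\<^esub> \<eta> x"
      using \<eta> a(1) by (auto simp: is_nat_iso_def id_fctr_def comp_fctr_def hom_def)
    then have "FArr G (FArr F a) = FArr G d"
      using F.C.iso_cancel_right \<eta>_iso[OF x] Gd G.FArr[OF F.FArr[OF a(1)]] a(2) by metis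
    then have "FArr F a = d"
      using nat_iso_to_id_faithful[OF F.D.category_axioms \<epsilon> F.FArr[OF a(1)] d] by simp
    with a(1) show ?thesis by blast
  qed
  show ?thesis
    unfolding bij_betw_iff_unique_preimage
    using F.FArr full nat_iso_id_faithful[OF F.C.category_axioms \<eta>, of _ x y]
    by metis
qed

lemma equivalence_essentially_surjective:
  assumes "is_equivalence C D F" and y: "y \<in> Obj D"
  obtains x e where "x \<in> Obj C" "e \<in> hom D (FObj F x) y" "is_iso D e"
proof -
  from assms(1) obtain G \<epsilon> where G: "is_functor D C G"
    and \<epsilon>: "is_nat_iso D D (comp_fctr F G) id_fctr \<epsilon>"
    unfolding is_equivalence_def by blast
  have "\<epsilon> y \<in> hom D (FObj F (FObj G y)) y" "is_iso D (\<epsilon> y)"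
    using \<epsilon> y by (auto simp: is_nat_iso_def id_fctr_def comp_fctr_def)
  with that is_functor.FObj[OF G y] show ?thesis by blast
qed

section \<open>Comma categories\<close>

lemma comma_Obj_iff:
  "(c, e, d) \<in> Obj (comma C D E F G) \<longleftrightarrow>
     c \<in> Obj C \<and> d \<in> Obj D \<and> e \<in> hom E (FObj F c) (FObj G d)"
  by (simp add: comma_def)

lemma comma_hom_iff:
  "(s, t, u, v) \<in> hom (comma C D E F G) (c, e, d) (c', e', d') \<longleftrightarrow>
     s = (c, e, d) \<and> t = (c', e', d') \<and>
     (c, e, d) \<in> Obj (comma C D E F G) \<and> (c', e', d') \<in> Obj (comma C D E F G) \<and>
     u \<in> hom C c c' \<and> v \<in> hom D d d' \<and> e' \<cdot>\<^bsub>E\<^esub> FArr F u = FArr G v \<cdot>\<^bsub>E\<^esub> e"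
  by (auto simp: comma_def hom_def)

text \<open>Composition and identities in a comma category are componentwise, so the components of
  an inverse arrow are inverses of the components.\<close>

lemma comma_iso_components:
  assumes "(s, t, u, v) \<in> hom (comma C D E F G) (c, e, d) (c', e', d')"
    and "is_iso (comma C D E F G) (s, t, u, v)"
  shows "is_iso C u" "is_iso D v"
proof -
  obtain s' t' u' v' where
    i: "(s', t', u', v') \<in> hom (comma C D E F G) (c', e', d') (c, e, d)"
    and l: "Comp (comma C D E F G) (s', t', u', v') (s, t, u, v) = Ide (comma C D E F G) (c, e, d)"
    and r: "Comp (comma C D E F G) (s, t, u, v) (s', t', u', v') = Ide (comma C D E F G) (c', e', d')"
    using assms is_iso_hom[OF assms(1)] by (metis prod_cases4)
  have u: "u \<in> hom C c c'" "u' \<in> hom C c' c" and v: "v \<in> hom D d d'" "v' \<in> hom D d' d"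
    using assms(1) i by (auto simp: comma_hom_iff)
  show "is_iso C u" using l r u is_iso_hom[OF u(1)] by (auto simp: comma_def)
  show "is_iso D v" using l r v is_iso_hom[OF v(1)] by (auto simp: comma_def)
qed

section \<open>Collages and right extensions\<close>

context bicategory
begin

sublocale Vert: category "Vert M"
  by (rule category_Vert)

lemma hom_hom_cat:
  "\<lbrakk>f \<in> hom1 M A B; g \<in> hom1 M A B\<rbrakk> \<Longrightarrow> hom (hom_cat M A B) f g = hom2 M f g"
  by (auto simp: hom_cat_def hom_def)

text \<open>A hom-category inherits composition and identities from \<open>Vert M\<close>, so an
  inverse found in it is also an inverse in \<open>Vert M\<close>.\<close>

lemma is_iso_hom_cat:
  "\<lbrakk>f \<in> hom1 M A B; g \<in> hom1 M A B; a \<in> hom2 M f g; is_iso (hom_cat M A B) a\<rbrakk>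
    \<Longrightarrow> invertible2 M a"
  using is_iso_hom[of a "hom_cat M A B" f g] is_iso_hom[of a "Vert M" f g]
  by (auto simp: hom_hom_cat) (auto simp: hom_cat_def)

lemma hom1_Obj: "f \<in> hom1 M A B \<Longrightarrow> f \<in> Obj (Vert M)"
  by (simp add: hom1_def)

lemma hom1_Trg_Ob: "f \<in> hom1 M A B \<Longrightarrow> B \<in> Ob M"
  using Trg_Ob by (auto simp: hom1_def)

lemma whisker_right_hom2:
  assumes "j \<in> hom1 M A B" "g \<in> hom1 M B X" "\<theta> \<in> hom2 M g g'"
  shows "\<theta> \<star> id2 M j \<in> hom2 M (g \<odot> j) (g' \<odot> j)"
  using HComp2_hom2[OF assms(1,2) Vert.Ide_hom[OF hom1_Obj[OF assms(1)]] assms(3)] .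

lemma whisker_right_vcomp:
  assumes j: "j \<in> hom1 M A B" and "g \<in> hom1 M B X" "\<theta> \<in> hom2 M g g'" "\<theta>' \<in> hom2 M g' g''"
  shows "(\<theta>' \<bullet> \<theta>) \<star> id2 M j = (\<theta>' \<star> id2 M j) \<bullet> (\<theta> \<star> id2 M j)"
proof -
  have i: "id2 M j \<in> hom2 M j j" using Vert.Ide_hom[OF hom1_Obj[OF j]] .
  show ?thesis
    using interchange[OF j assms(2) i i assms(3,4)] Vert.Comp_Ide[OF i] by simp
qed

text \<open>The 1-morphisms determine their sources and targets, so the existential quantifiers of
  the definition collapse. Typing of the assignment is automatic, and its bijectivity becomes unique
  factorisation.\<close>

lemma exhibits_right_extension_iff:
  assumes "j \<in> hom1 M A B" "f \<in> hom1 M A X" "r \<in> hom1 M B X" "\<rho> \<in> hom2 M (r \<odot> j) f"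
  shows "exhibits_right_extension M j f r \<rho> \<longleftrightarrow>
    (\<forall>g \<in> hom1 M B X. \<forall>\<tau> \<in> hom2 M (g \<odot> j) f.
      \<exists>!\<theta>. \<theta> \<in> hom2 M g r \<and> \<rho> \<bullet> (\<theta> \<star> id2 M j) = \<tau>)"
proof -
  have "exhibits_right_extension M j f r \<rho> \<longleftrightarrow>
    (\<forall>g \<in> hom1 M B X. bij_betw (\<lambda>\<theta>. \<rho> \<bullet> (\<theta> \<star> id2 M j)) (hom2 M g r) (hom2 M (g \<odot> j) f))"
    using assms unfolding exhibits_right_extension_def by (auto simp: hom1_def)
  moreover have "\<rho> \<bullet> (\<theta> \<star> id2 M j) \<in> hom2 M (g \<odot> j) f"
    if "g \<in> hom1 M B X" "\<theta> \<in> hom2 M g r" for g \<theta>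
    using Vert.Comp_hom[OF whisker_right_hom2[OF assms(1) that] assms(4)] .
  ultimately show ?thesis by (simp add: bij_betw_iff_unique_preimage)
qed

end

section \<open>The universal property of a collage in terms of 2-morphisms\<close>

locale collage = bicategory +
  fixes A B C :: 'a and j i\<^sub>0 i\<^sub>1 :: 'b and \<nu> :: 'c
  assumes is_collage: "is_collage M A B j C i\<^sub>0 i\<^sub>1 \<nu>"
begin

abbreviation W where "W \<equiv> whisker_cocone M j i\<^sub>0 \<nu>"

abbreviation comma_cat where
  "comma_cat X \<equiv> comma (hom_cat M B X) (hom_cat M A X) (hom_cat M A X) (precomp M j) id_fctr"

lemma j: "j \<in> hom1 M A B" and i\<^sub>0: "i\<^sub>0 \<in> hom1 M B C" and i\<^sub>1: "i\<^sub>1 \<in> hom1 M A C"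
  and \<nu>: "\<nu> \<in> hom2 M (i\<^sub>0 \<odot> j) i\<^sub>1"
  using is_collage by (auto simp: is_collage_def)

lemma equivalence:
  "X \<in> Ob M \<Longrightarrow> is_equivalence (hom_cat M C X) (comma_cat X) (collage_fctr M j i\<^sub>0 i\<^sub>1 \<nu>)"
  using is_collage by (auto simp: is_collage_def)

lemma FObj_collage_fctr: "FObj (collage_fctr M j i\<^sub>0 i\<^sub>1 \<nu>) h = (h \<odot> i\<^sub>0, W h, h \<odot> i\<^sub>1)"
  by (simp add: collage_fctr_def)

lemma FArr_collage_fctr:
  "\<theta> \<in> hom2 M g h \<Longrightarrow> FArr (collage_fctr M j i\<^sub>0 i\<^sub>1 \<nu>) \<theta> =
     ((g \<odot> i\<^sub>0, W g, g \<odot> i\<^sub>1), (h \<odot> i\<^sub>0, W h, h \<odot> i\<^sub>1), \<theta> \<star> id2 M i\<^sub>0, \<theta> \<star> id2 M i\<^sub>1)"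
  by (simp add: collage_fctr_def hom_def)

lemma comma_Obj:
  "(r, \<rho>, f) \<in> Obj (comma_cat X) \<longleftrightarrow> r \<in> hom1 M B X \<and> f \<in> hom1 M A X \<and> \<rho> \<in> hom2 M (r \<odot> j) f"
  using HComp_hom1[OF j, of r X]
  by (auto simp: comma_Obj_iff precomp_def id_fctr_def hom_hom_cat)
    (auto simp: hom_cat_def hom_hom_cat[unfolded hom_cat_def])

lemma comma_hom:
  "(s, t, u, v) \<in> hom (comma_cat X) (r, \<rho>, f) (r', \<rho>', f') \<longleftrightarrow>
     s = (r, \<rho>, f) \<and> t = (r', \<rho>', f') \<and>
     (r, \<rho>, f) \<in> Obj (comma_cat X) \<and> (r', \<rho>', f') \<in> Obj (comma_cat X) \<and>
     u \<in> hom2 M r r' \<and> v \<in> hom2 M f f' \<and> \<rho>' \<bullet> (u \<star> id2 M j) = v \<bullet> \<rho>"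
  by (auto simp: comma_hom_iff comma_Obj hom_hom_cat)
    (auto simp: precomp_def id_fctr_def hom_cat_def)

lemma W_hom2:
  assumes h: "h \<in> hom1 M C X"
  shows "W h \<in> hom2 M ((h \<odot> i\<^sub>0) \<odot> j) (h \<odot> i\<^sub>1)"
  unfolding whisker_cocone_def
  using Vert.Comp_hom[OF Assoc_hom2[OF j i\<^sub>0 h]]
    HComp2_hom2[OF HComp_hom1[OF j i\<^sub>0] h \<nu> Vert.Ide_hom[OF hom1_Obj[OF h]]] .

text \<open>This is full faithfulness of the collage functor, stated for bare pairs of 2-morphisms
  instead of arrows of the comma category.\<close>

lemma fully_faithful:
  assumes g: "g \<in> hom1 M C X" and h: "h \<in> hom1 M C X"
  shows "bij_betw (\<lambda>\<theta>. (\<theta> \<star> id2 M i\<^sub>0, \<theta> \<star> id2 M i\<^sub>1)) (hom2 M g h)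
    {(u, v). u \<in> hom2 M (g \<odot> i\<^sub>0) (h \<odot> i\<^sub>0) \<and> v \<in> hom2 M (g \<odot> i\<^sub>1) (h \<odot> i\<^sub>1) \<and>
      W h \<bullet> (u \<star> id2 M j) = v \<bullet> W g}"
proof -
  have Obj: "(k \<odot> i\<^sub>0, W k, k \<odot> i\<^sub>1) \<in> Obj (comma_cat X)" if "k \<in> hom1 M C X" for k
    using that HComp_hom1 i\<^sub>0 i\<^sub>1 W_hom2 by (auto simp: comma_Obj)
  let ?s = "(g \<odot> i\<^sub>0, W g, g \<odot> i\<^sub>1)" and ?t = "(h \<odot> i\<^sub>0, W h, h \<odot> i\<^sub>1)"
  have "bij_betw (FArr (collage_fctr M j i\<^sub>0 i\<^sub>1 \<nu>)) (hom2 M g h) (hom (comma_cat X) ?s ?t)"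
    using equivalence_fully_faithful[OF equivalence[OF hom1_Trg_Ob[OF g]], of g h]
      g h hom_hom_cat[OF g h] by (simp add: FObj_collage_fctr) (simp add: hom_cat_def)
  then have ff: "bij_betw (\<lambda>\<theta>. (?s, ?t, \<theta> \<star> id2 M i\<^sub>0, \<theta> \<star> id2 M i\<^sub>1))
      (hom2 M g h) (hom (comma_cat X) ?s ?t)"
    by (subst (asm) bij_betw_cong) (auto simp: FArr_collage_fctr)
  \<comment> \<open>An arrow of the comma category carries its source and target triples; these are
    fixed here, so forgetting them loses nothing.\<close>
  have proj: "bij_betw (\<lambda>(_, _, u, v). (u, v)) (hom (comma_cat X) ?s ?t)
    {(u, v). u \<in> hom2 M (g \<odot> i\<^sub>0) (h \<odot> i\<^sub>0) \<and> v \<in> hom2 M (g \<odot> i\<^sub>1) (h \<odot> i\<^sub>1) \<and>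
      W h \<bullet> (u \<star> id2 M j) = v \<bullet> W g}"
    by (rule bij_betw_byWitness[where f' = "\<lambda>(u, v). (?s, ?t, u, v)"])
      (use Obj[OF g] Obj[OF h] in \<open>auto simp: comma_hom\<close>)
  show ?thesis using bij_betw_trans[OF ff proj] by (simp add: comp_def)
qed

text \<open>Each triple is isomorphic in the comma category to the image of some \<open>k\<close>;
  that isomorphism is unpacked into its two invertible components and their compatibility. Both
  components point from the image of \<open>k\<close> to the given triple.\<close>

lemma essentially_surjective:
  assumes "r \<in> hom1 M B X" "f \<in> hom1 M A X" "\<rho> \<in> hom2 M (r \<odot> j) f"
  obtains k u v where "k \<in> hom1 M C X"
    "u \<in> hom2 M (k \<odot> i\<^sub>0) r" "invertible2 M u" "v \<in> hom2 M (k \<odot> i\<^sub>1) f" "invertible2 M v"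
    "\<rho> \<bullet> (u \<star> id2 M j) = v \<bullet> W k"
proof -
  have "(r, \<rho>, f) \<in> Obj (comma_cat X)" using assms by (simp add: comma_Obj)
  then obtain k e where "k \<in> Obj (hom_cat M C X)"
    and e: "e \<in> hom (comma_cat X) (k \<odot> i\<^sub>0, W k, k \<odot> i\<^sub>1) (r, \<rho>, f)" "is_iso (comma_cat X) e"
    using equivalence_essentially_surjective[OF equivalence[OF hom1_Trg_Ob[OF assms(1)]]]
    unfolding FObj_collage_fctr by metis
  then have k: "k \<in> hom1 M C X" by (simp add: hom_cat_def)
  obtain s t u v where eq: "e = (s, t, u, v)" by (metis prod_cases4)
  note uv = e(1)[unfolded eq comma_hom]
  have "invertible2 M u" "invertible2 M v"
    using comma_iso_components[OF e[unfolded eq]] uv assms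
      is_iso_hom_cat[OF HComp_hom1[OF i\<^sub>0 k] assms(1)]
      is_iso_hom_cat[OF HComp_hom1[OF i\<^sub>1 k] assms(2)] by auto
  with that k uv show ?thesis by blast
qed

end

section \<open>The induced 1-morphism and the two implications\<close>

locale induced_1_morphism = collage +
  fixes X :: 'a and r f h :: 'b and \<rho> \<phi>\<^sub>0 \<phi>\<^sub>1 :: 'c
  assumes r: "r \<in> hom1 M B X" and f: "f \<in> hom1 M A X"
    and is_induced: "is_induced M C X j i\<^sub>0 i\<^sub>1 \<nu> r \<rho> f h \<phi>\<^sub>0 \<phi>\<^sub>1"
begin

lemma h: "h \<in> hom1 M C X"
  and \<phi>\<^sub>0: "\<phi>\<^sub>0 \<in> hom2 M r (h \<odot> i\<^sub>0)" and \<phi>\<^sub>0_inv: "invertible2 M \<phi>\<^sub>0"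
  and \<phi>\<^sub>1: "\<phi>\<^sub>1 \<in> hom2 M (h \<odot> i\<^sub>1) f" and \<phi>\<^sub>1_inv: "invertible2 M \<phi>\<^sub>1"
  and conjugate: "\<phi>\<^sub>1 \<bullet> W h \<bullet> (\<phi>\<^sub>0 \<star> id2 M j) = \<rho>"
  using is_induced by (auto simp: is_induced_def)

lemma \<phi>\<^sub>1_W: "\<phi>\<^sub>1 \<bullet> W h \<in> hom2 M ((h \<odot> i\<^sub>0) \<odot> j) f"
  using Vert.Comp_hom[OF W_hom2[OF h] \<phi>\<^sub>1] .

lemma \<rho>: "\<rho> \<in> hom2 M (r \<odot> j) f"
  using Vert.Comp_hom[OF whisker_right_hom2[OF j r \<phi>\<^sub>0] \<phi>\<^sub>1_W] conjugate by simp

text \<open>Substituting the expression of \<open>\<rho>\<close> through \<open>W h\<close> leaves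
  two successive whiskerings by \<open>j\<close>, which merge because whiskering preserves vertical
  composition.\<close>

lemma \<rho>_whisker:
  assumes "g \<in> hom1 M B X" "\<theta> \<in> hom2 M g r"
  shows "\<rho> \<bullet> (\<theta> \<star> id2 M j) = \<phi>\<^sub>1 \<bullet> (W h \<bullet> ((\<phi>\<^sub>0 \<bullet> \<theta>) \<star> id2 M j))"
  using Vert.Comp_assoc[OF whisker_right_hom2[OF j assms] whisker_right_hom2[OF j r \<phi>\<^sub>0] \<phi>\<^sub>1_W]
    whisker_right_vcomp[OF j assms \<phi>\<^sub>0] conjugate
    Vert.Comp_assoc[OF whisker_right_hom2[OF j assms(1) Vert.Comp_hom[OF assms(2) \<phi>\<^sub>0]] W_hom2[OF h] \<phi>\<^sub>1]
  by simp

text \<open>Composing with the invertible \<open>\<phi>\<^sub>1\<close> turns \<open>W h\<close>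
  into \<open>\<rho>\<close>. Thus the condition for the pair
  \<open>(\<phi>\<^sub>0 \<bullet> u, v)\<close> to come from a 2-morphism
  \<open>g \<Rightarrow> h\<close> becomes a factorisation problem for \<open>\<rho>\<close>. Both
  implications rest on this translation.\<close>

lemma compatible_iff:
  assumes g: "g \<in> hom1 M C X" and u: "u \<in> hom2 M (g \<odot> i\<^sub>0) r"
    and v: "v \<in> hom2 M (g \<odot> i\<^sub>1) (h \<odot> i\<^sub>1)"
  shows "W h \<bullet> ((\<phi>\<^sub>0 \<bullet> u) \<star> id2 M j) = v \<bullet> W g \<longleftrightarrow>
    \<rho> \<bullet> (u \<star> id2 M j) = (\<phi>\<^sub>1 \<bullet> v) \<bullet> W g"
proof -
  note gi\<^sub>0 = HComp_hom1[OF i\<^sub>0 g]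
  have l: "W h \<bullet> ((\<phi>\<^sub>0 \<bullet> u) \<star> id2 M j) \<in> hom2 M ((g \<odot> i\<^sub>0) \<odot> j) (h \<odot> i\<^sub>1)"
    using Vert.Comp_hom[OF whisker_right_hom2[OF j gi\<^sub>0 Vert.Comp_hom[OF u \<phi>\<^sub>0]] W_hom2[OF h]] .
  have r: "v \<bullet> W g \<in> hom2 M ((g \<odot> i\<^sub>0) \<odot> j) (h \<odot> i\<^sub>1)"
    using Vert.Comp_hom[OF W_hom2[OF g] v] .
  show ?thesis
    using \<rho>_whisker[OF gi\<^sub>0 u] Vert.Comp_assoc[OF W_hom2[OF g] v \<phi>\<^sub>1]
      Vert.iso_cancel_left[OF \<phi>\<^sub>1 \<phi>\<^sub>1_inv l r] by auto
qed

text \<open>The component at \<open>i\<^sub>1\<close> of a solution is forced by invertibility of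
  \<open>\<phi>\<^sub>1\<close>; the component at \<open>i\<^sub>0\<close> is then forced by the
  extension property of \<open>\<rho>\<close>.\<close>

lemma right_extension_along_i\<^sub>1:
  assumes ext: "exhibits_right_extension M j f r \<rho>"
  shows "exhibits_right_extension M i\<^sub>1 f h \<phi>\<^sub>1"
  unfolding exhibits_right_extension_iff[OF i\<^sub>1 f h \<phi>\<^sub>1]
proof (intro ballI)
  fix g \<tau> assume g: "g \<in> hom1 M C X" and \<tau>: "\<tau> \<in> hom2 M (g \<odot> i\<^sub>1) f"
  note gi\<^sub>0 = HComp_hom1[OF i\<^sub>0 g] and gi\<^sub>1 = HComp_hom1[OF i\<^sub>1 g]
  obtain v where v: "v \<in> hom2 M (g \<odot> i\<^sub>1) (h \<odot> i\<^sub>1)" "\<phi>\<^sub>1 \<bullet> v = \<tau>"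
    using Vert.iso_factor_left[OF \<phi>\<^sub>1 \<phi>\<^sub>1_inv \<tau>] by blast
  \<comment> \<open>The extension property of \<open>\<rho>\<close> is applied to
    \<open>g \<odot> i\<^sub>0\<close> and to the 2-morphism \<open>\<tau> \<bullet> W g\<close>, as
    compatibility with \<open>v\<close> demands.\<close>
  have ex1: "\<exists>!u. u \<in> hom2 M (g \<odot> i\<^sub>0) r \<and> \<rho> \<bullet> (u \<star> id2 M j) = \<tau> \<bullet> W g"
    using ext gi\<^sub>0 Vert.Comp_hom[OF W_hom2[OF g] \<tau>]
    unfolding exhibits_right_extension_iff[OF j f r \<rho>] by blast
  then obtain u where u: "u \<in> hom2 M (g \<odot> i\<^sub>0) r" "\<rho> \<bullet> (u \<star> id2 M j) = \<tau> \<bullet> W g" by blast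
  note ff = fully_faithful[OF g h, unfolded bij_betw_iff_unique_preimage]
  obtain \<theta> where \<theta>: "\<theta> \<in> hom2 M g h" "\<theta> \<star> id2 M i\<^sub>0 = \<phi>\<^sub>0 \<bullet> u" "\<theta> \<star> id2 M i\<^sub>1 = v"
    using ff compatible_iff[OF g u(1) v(1)] u(2) v Vert.Comp_hom[OF u(1) \<phi>\<^sub>0] by blast
  show "\<exists>!\<theta>. \<theta> \<in> hom2 M g h \<and> \<phi>\<^sub>1 \<bullet> (\<theta> \<star> id2 M i\<^sub>1) = \<tau>"
  proof (rule ex1I[of _ \<theta>])
    show "\<theta> \<in> hom2 M g h \<and> \<phi>\<^sub>1 \<bullet> (\<theta> \<star> id2 M i\<^sub>1) = \<tau>" using \<theta> v by simp
  next
    fix \<theta>' assume "\<theta>' \<in> hom2 M g h \<and> \<phi>\<^sub>1 \<bullet> (\<theta>' \<star> id2 M i\<^sub>1) = \<tau>"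
    then have \<theta>': "\<theta>' \<in> hom2 M g h" and eq: "\<phi>\<^sub>1 \<bullet> (\<theta>' \<star> id2 M i\<^sub>1) = \<tau>" by auto
    have v': "\<theta>' \<star> id2 M i\<^sub>1 = v"
      using Vert.iso_cancel_left[OF \<phi>\<^sub>1 \<phi>\<^sub>1_inv whisker_right_hom2[OF i\<^sub>1 g \<theta>'] v(1)] eq v(2) by simp
    \<comment> \<open>Removing \<open>\<phi>\<^sub>0\<close> from the other component of the
      competitor \<open>\<theta>'\<close> makes it comparable with \<open>u\<close>.\<close>
    obtain u' where u': "u' \<in> hom2 M (g \<odot> i\<^sub>0) r" "\<phi>\<^sub>0 \<bullet> u' = \<theta>' \<star> id2 M i\<^sub>0"
      using Vert.iso_factor_left[OF \<phi>\<^sub>0 \<phi>\<^sub>0_inv whisker_right_hom2[OF i\<^sub>0 g \<theta>']] by blast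
    have "W h \<bullet> ((\<phi>\<^sub>0 \<bullet> u') \<star> id2 M j) = v \<bullet> W g" using ff \<theta>' u'(2) v' by auto
    then have "\<rho> \<bullet> (u' \<star> id2 M j) = \<tau> \<bullet> W g" using compatible_iff[OF g u'(1) v(1)] v(2) by simp
    then have "u' = u" using ex1 u u'(1) by blast
    then show "\<theta>' = \<theta>"
      using fully_faithful[OF g h] \<theta> \<theta>' u'(2) v' by (auto simp: bij_betw_def inj_on_def)
  qed
qed

text \<open>Given \<open>g\<close> and \<open>\<tau>\<close>, the solutions
  \<open>u : g \<Rightarrow> r\<close> are matched with the solutions
  \<open>\<theta> : k \<Rightarrow> h\<close> of an extension problem along
  \<open>i\<^sub>1\<close>, the component of \<open>\<theta>\<close> at \<open>i\<^sub>0\<close>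
  being \<open>\<phi>\<^sub>0 \<bullet> (u \<bullet> u\<^sub>0)\<close>.\<close>

lemma right_extension_along_j:
  assumes ext: "exhibits_right_extension M i\<^sub>1 f h \<phi>\<^sub>1"
  shows "exhibits_right_extension M j f r \<rho>"
  unfolding exhibits_right_extension_iff[OF j f r \<rho>]
proof (intro ballI)
  fix g \<tau> assume g: "g \<in> hom1 M B X" and \<tau>: "\<tau> \<in> hom2 M (g \<odot> j) f"
  note gj = HComp_hom1[OF j g]
  \<comment> \<open>Essential surjectivity is applied to the triple of \<open>g\<close>, the
    identity of \<open>g \<odot> j\<close>, and \<open>g \<odot> j\<close>.\<close>
  obtain k u\<^sub>0 v\<^sub>0 where k: "k \<in> hom1 M C X"
    and u\<^sub>0: "u\<^sub>0 \<in> hom2 M (k \<odot> i\<^sub>0) g" "invertible2 M u\<^sub>0" and v\<^sub>0: "v\<^sub>0 \<in> hom2 M (k \<odot> i\<^sub>1) (g \<odot> j)"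
    and "id2 M (g \<odot> j) \<bullet> (u\<^sub>0 \<star> id2 M j) = v\<^sub>0 \<bullet> W k"
    using essentially_surjective[OF g gj Vert.Ide_hom[OF hom1_Obj[OF gj]]] by metis
  note ki\<^sub>0 = HComp_hom1[OF i\<^sub>0 k]
  have u\<^sub>0_j: "u\<^sub>0 \<star> id2 M j \<in> hom2 M ((k \<odot> i\<^sub>0) \<odot> j) (g \<odot> j)"
    using whisker_right_hom2[OF j ki\<^sub>0 u\<^sub>0(1)] .
  have u\<^sub>0_v\<^sub>0: "u\<^sub>0 \<star> id2 M j = v\<^sub>0 \<bullet> W k"
    using \<open>id2 M (g \<odot> j) \<bullet> _ = _\<close> Vert.Ide_Comp[OF u\<^sub>0_j] by simp
  note ff = fully_faithful[OF k h, unfolded bij_betw_iff_unique_preimage]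
  have ext_k: "\<exists>!\<theta>. \<theta> \<in> hom2 M k h \<and> \<phi>\<^sub>1 \<bullet> (\<theta> \<star> id2 M i\<^sub>1) = \<tau> \<bullet> v\<^sub>0"
    using ext k Vert.Comp_hom[OF v\<^sub>0 \<tau>] unfolding exhibits_right_extension_iff[OF i\<^sub>1 f h \<phi>\<^sub>1] by blast
  obtain v where v: "v \<in> hom2 M (k \<odot> i\<^sub>1) (h \<odot> i\<^sub>1)" "\<phi>\<^sub>1 \<bullet> v = \<tau> \<bullet> v\<^sub>0"
    using Vert.iso_factor_left[OF \<phi>\<^sub>1 \<phi>\<^sub>1_inv Vert.Comp_hom[OF v\<^sub>0 \<tau>]] by blast
  \<comment> \<open>A right inverse \<open>w\<close> of \<open>u\<^sub>0\<close>, whiskered by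
    \<open>j\<close>, is a right inverse of the whiskered \<open>u\<^sub>0\<close>, which can
    therefore be cancelled on the right.\<close>
  have u\<^sub>0_j_epi: "a = b" if "a \<in> hom2 M (g \<odot> j) f" "b \<in> hom2 M (g \<odot> j) f"
    "a \<bullet> (u\<^sub>0 \<star> id2 M j) = b \<bullet> (u\<^sub>0 \<star> id2 M j)" for a b
  proof -
    obtain w where w: "w \<in> hom2 M g (k \<odot> i\<^sub>0)" "u\<^sub>0 \<bullet> w = id2 M g"
      using is_iso_hom[OF u\<^sub>0(1)] u\<^sub>0(2) by blast
    have w_j: "w \<star> id2 M j \<in> hom2 M (g \<odot> j) ((k \<odot> i\<^sub>0) \<odot> j)" using whisker_right_hom2[OF j g w(1)] .
    have "(u\<^sub>0 \<star> id2 M j) \<bullet> (w \<star> id2 M j) = id2 M (g \<odot> j)"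
      using whisker_right_vcomp[OF j g w(1) u\<^sub>0(1)] w(2) HComp2_id2[OF j g] by simp
    then show ?thesis
      using Vert.Comp_assoc[OF w_j u\<^sub>0_j that(1)] Vert.Comp_assoc[OF w_j u\<^sub>0_j that(2)] that
        Vert.Comp_Ide by metis
  qed
  have \<tau>_assoc: "\<tau> \<bullet> (u\<^sub>0 \<star> id2 M j) = \<phi>\<^sub>1 \<bullet> v \<bullet> W k"
    using Vert.Comp_assoc[OF W_hom2[OF k] v\<^sub>0 \<tau>] u\<^sub>0_v\<^sub>0 v(2) by simp
  \<comment> \<open>The equation for \<open>u\<close> is tested after precomposition with the
    whiskered \<open>u\<^sub>0\<close>, where \<open>compatible_iff\<close> applies at
    \<open>k\<close> to \<open>u \<bullet> u\<^sub>0\<close>.\<close>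
  have compat: "\<rho> \<bullet> (u \<star> id2 M j) = \<tau> \<longleftrightarrow> W h \<bullet> ((\<phi>\<^sub>0 \<bullet> (u \<bullet> u\<^sub>0)) \<star> id2 M j) = v \<bullet> W k"
    if u: "u \<in> hom2 M g r" for u
  proof -
    note \<rho>u = Vert.Comp_hom[OF whisker_right_hom2[OF j g u] \<rho>]
    have "\<rho> \<bullet> (u \<star> id2 M j) = \<tau> \<longleftrightarrow>
        \<rho> \<bullet> (u \<star> id2 M j) \<bullet> (u\<^sub>0 \<star> id2 M j) = \<tau> \<bullet> (u\<^sub>0 \<star> id2 M j)"
      using u\<^sub>0_j_epi[OF \<rho>u \<tau>] by auto
    also have "\<dots> \<longleftrightarrow> \<rho> \<bullet> ((u \<bullet> u\<^sub>0) \<star> id2 M j) = \<phi>\<^sub>1 \<bullet> v \<bullet> W k"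
      using Vert.Comp_assoc[OF u\<^sub>0_j whisker_right_hom2[OF j g u] \<rho>]
        whisker_right_vcomp[OF j ki\<^sub>0 u\<^sub>0(1) u] \<tau>_assoc by simp
    finally show ?thesis using compatible_iff[OF k Vert.Comp_hom[OF u\<^sub>0(1) u] v(1)] by simp
  qed
  have lift: "\<exists>\<theta>. \<theta> \<in> hom2 M k h \<and> \<theta> \<star> id2 M i\<^sub>0 = \<phi>\<^sub>0 \<bullet> (u \<bullet> u\<^sub>0) \<and> \<theta> \<star> id2 M i\<^sub>1 = v"
    if "u \<in> hom2 M g r" "\<rho> \<bullet> (u \<star> id2 M j) = \<tau>" for u
    using ff compat[OF that(1)] that(2) v(1)
      Vert.Comp_hom[OF Vert.Comp_hom[OF u\<^sub>0(1) that(1)] \<phi>\<^sub>0] by blast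
  obtain \<theta> where \<theta>: "\<theta> \<in> hom2 M k h" "\<phi>\<^sub>1 \<bullet> (\<theta> \<star> id2 M i\<^sub>1) = \<tau> \<bullet> v\<^sub>0"
    using ext_k by blast
  have \<theta>_i\<^sub>1: "\<theta> \<star> id2 M i\<^sub>1 = v"
    using Vert.iso_cancel_left[OF \<phi>\<^sub>1 \<phi>\<^sub>1_inv whisker_right_hom2[OF i\<^sub>1 k \<theta>(1)] v(1)] \<theta>(2) v(2) by simp
  obtain u' where u': "u' \<in> hom2 M (k \<odot> i\<^sub>0) r" "\<phi>\<^sub>0 \<bullet> u' = \<theta> \<star> id2 M i\<^sub>0"
    using Vert.iso_factor_left[OF \<phi>\<^sub>0 \<phi>\<^sub>0_inv whisker_right_hom2[OF i\<^sub>0 k \<theta>(1)]] by blast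
  \<comment> \<open>The solution is the component of \<open>\<theta>\<close> at
    \<open>i\<^sub>0\<close> with the invertible \<open>\<phi>\<^sub>0\<close> and
    \<open>u\<^sub>0\<close> stripped off.\<close>
  obtain u where u: "u \<in> hom2 M g r" "u \<bullet> u\<^sub>0 = u'"
    using Vert.iso_factor_right[OF u\<^sub>0 u'(1)] by blast
  show "\<exists>!u. u \<in> hom2 M g r \<and> \<rho> \<bullet> (u \<star> id2 M j) = \<tau>"
  proof (rule ex1I[of _ u])
    have "W h \<bullet> ((\<phi>\<^sub>0 \<bullet> (u \<bullet> u\<^sub>0)) \<star> id2 M j) = v \<bullet> W k"
      using ff \<theta>(1) \<theta>_i\<^sub>1 u(2) u'(2) by auto
    then show "u \<in> hom2 M g r \<and> \<rho> \<bullet> (u \<star> id2 M j) = \<tau>" using compat u(1) by simp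
  next
    fix w assume w: "w \<in> hom2 M g r \<and> \<rho> \<bullet> (w \<star> id2 M j) = \<tau>"
    then obtain \<theta>' where \<theta>': "\<theta>' \<in> hom2 M k h" "\<theta>' \<star> id2 M i\<^sub>0 = \<phi>\<^sub>0 \<bullet> (w \<bullet> u\<^sub>0)" "\<theta>' \<star> id2 M i\<^sub>1 = v"
      using lift by blast
    \<comment> \<open>The lift of any other solution has component \<open>v\<close> at
      \<open>i\<^sub>1\<close>, so it solves the same problem as \<open>\<theta>\<close> and
      coincides with it. Cancelling \<open>\<phi>\<^sub>0\<close> and \<open>u\<^sub>0\<close>
      brings the equality back to 2-morphisms \<open>g \<Rightarrow> r\<close>.\<close>
    then have "\<theta>' = \<theta>" using ext_k \<theta> v(2) by metis
    then have "w \<bullet> u\<^sub>0 = u \<bullet> u\<^sub>0"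
      using Vert.iso_cancel_left[OF \<phi>\<^sub>0 \<phi>\<^sub>0_inv Vert.Comp_hom[OF u\<^sub>0(1) conjunct1[OF w]] u'(1)]
        \<theta>'(2) u(2) u'(2) by simp
    then show "w = u" using Vert.iso_cancel_right[OF u\<^sub>0 conjunct1[OF w] u(1)] by simp
  qed
qed

end

theorem proposition4:
  fixes M :: "('o, 'm, 'c) bicat"
    and A B X C :: 'o
    and j f r i\<^sub>0 i\<^sub>1 h :: 'm
    and \<rho> \<nu> \<phi>\<^sub>0 \<phi>\<^sub>1 :: 'c
  assumes "bicategory M"
    and "j \<in> hom1 M A B" and "f \<in> hom1 M A X" and "r \<in> hom1 M B X"
    and "\<rho> \<in> hom2 M (r \<odot>\<^bsub>M\<^esub> j) f"
    and "is_collage M A B j C i\<^sub>0 i\<^sub>1 \<nu>"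
    and "is_induced M C X j i\<^sub>0 i\<^sub>1 \<nu> r \<rho> f h \<phi>\<^sub>0 \<phi>\<^sub>1"
  shows "exhibits_right_extension M i\<^sub>1 f h \<phi>\<^sub>1 \<longleftrightarrow> exhibits_right_extension M j f r \<rho>"
proof -
  interpret induced_1_morphism M A B C j i\<^sub>0 i\<^sub>1 \<nu> X r f h \<rho> \<phi>\<^sub>0 \<phi>\<^sub>1
    using assms by (simp add: induced_1_morphism_def induced_1_morphism_axioms_def
        collage_def collage_axioms_def)
  show ?thesis using right_extension_along_i\<^sub>1 right_extension_along_j by blast
qed

end
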